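(* Let $b_{ik}$ ($i,k\in\{1,2,3\}$) be real numbers and let $V$ be the diagonal quadratic operator given by $$(V(\mathbf f))_k=\sum_{i=1}^3 b_{ik}f_i^2,\qquad k=1,2,3,\ \mathbf f=(f_1,f_2,f_3)\in S .$$ Assume that $$\sum_{k=1}^3\max_{i}\{|b_{ik}|^2\}<1 .$$ Then $V$ has a unique stable fixed point $(0,0,0)$.
   Context: $S=\{\mathbf p\in\mathbb{R}^3: p_1^2+p_2^2+p_3^2\le 1\}$ is the closed Euclidean unit ball; under the stated assumption $V$ maps $S$ into itself. "$V$ has a unique stable fixed point $(0,0,0)$" means that $(0,0,0)$ is the only fixed point of $V$ in $S$ and $V^n(\mathbf f)\to(0,0,0)$ as $n\to\infty$ for every $\mathbf f\in S$, where $V^n$ is the $n$-th iterate. *)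

theory Defs
  imports "HOL-Analysis.Analysis"
begin

text \<open>The coefficient \<open>b\<^sub>i\<^sub>k\<close> is \<open>b $ i $ k\<close>, so the output coordinate \<open>k\<close> is the column index.
  The operator is defined on all of \<open>real^3\<close>; the domain \<open>S\<close> is \<open>cball 0 1\<close>.\<close>

definition diag_quadratic_op :: "real^3^3 \<Rightarrow> real^3 \<Rightarrow> real^3" where
  "diag_quadratic_op b f = (\<chi> k. \<Sum>i\<in>UNIV. b $ i $ k * (f $ i)\<^sup>2)"

definition unique_stable_fixed_point :: "'a::topological_space set \<Rightarrow> ('a \<Rightarrow> 'a) \<Rightarrow> 'a \<Rightarrow> bool" where
  "unique_stable_fixed_point S V p \<longleftrightarrow>
     {q \<in> S. V q = q} = {p} \<and> (\<forall>f\<in>S. (\<lambda>n. (V ^^ n) f) \<longlonglongrightarrow> p)"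

lemma cball_real3_eq: "cball 0 1 = {p :: real^3. (p$1)\<^sup>2 + (p$2)\<^sup>2 + (p$3)\<^sup>2 \<le> 1}"
  by (auto simp: norm_vec_def L2_set_def sum_3)

text \<open>The restriction to the unit ball is a self-map, so the iterates in
  \<open>unique_stable_fixed_point\<close> are iterates of that restriction.\<close>

lemma diag_quadratic_op_maps_ball:
  fixes b :: "real^3^3"
  assumes "(\<Sum>k\<in>UNIV. MAX i. \<bar>b $ i $ k\<bar>\<^sup>2) < 1"
  shows "diag_quadratic_op b ` cball 0 1 \<subseteq> cball 0 1"
proof
  fix y assume "y \<in> diag_quadratic_op b ` cball 0 1"
  then obtain f where f: "f \<in> cball 0 1" and y: "y = diag_quadratic_op b f" by blast
  have s: "(\<Sum>i\<in>UNIV. (f $ i)\<^sup>2) \<le> 1"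
    using f by (simp add: cball_real3_eq sum_3)
  have "(y $ k)\<^sup>2 \<le> (MAX i. \<bar>b $ i $ k\<bar>\<^sup>2)" for k
  proof -
    define M where "M = (MAX i. \<bar>b $ i $ k\<bar>\<^sup>2)"
    have M: "\<bar>b $ i $ k\<bar>\<^sup>2 \<le> M" for i
      unfolding M_def by (rule Max_ge) auto
    have M0: "0 \<le> M" using M[of 1] zero_le_power2 order_trans by blast
    have c: "\<bar>b $ i $ k\<bar> \<le> sqrt M" for i
      using M[of i] real_le_rsqrt by blast
    have "\<bar>y $ k\<bar> \<le> (\<Sum>i\<in>UNIV. \<bar>b $ i $ k * (f $ i)\<^sup>2\<bar>)"
      unfolding y diag_quadratic_op_def by simp
    also have "\<dots> \<le> (\<Sum>i\<in>UNIV. sqrt M * (f $ i)\<^sup>2)"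
      by (rule sum_mono) (simp add: abs_mult c mult_right_mono)
    also have "\<dots> = sqrt M * (\<Sum>i\<in>UNIV. (f $ i)\<^sup>2)"
      by (simp add: sum_distrib_left)
    also have "\<dots> \<le> sqrt M"
      using mult_left_mono[OF s, of "sqrt M"] M0 by simp
    finally have "\<bar>y $ k\<bar>\<^sup>2 \<le> (sqrt M)\<^sup>2"
      by (rule power_mono) simp
    then show ?thesis using M0 by (simp add: M_def)
  qed
  then have "(\<Sum>k\<in>UNIV. (y $ k)\<^sup>2) \<le> (\<Sum>k\<in>UNIV. MAX i. \<bar>b $ i $ k\<bar>\<^sup>2)"
    by (intro sum_mono)
  with assms show "y \<in> cball 0 1"
    by (simp add: cball_real3_eq sum_3)
qed

end

theory Submission
  imports Defs
begin

text \<open>With \<open>C < 1\<close> the sum in the hypothesis, each coordinate of \<open>V f\<close> is at most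
  \<open>max\<^sub>i \<bar>b\<^sub>i\<^sub>k\<bar> \<cdot> \<parallel>f\<parallel>\<^sup>2\<close>, so \<open>\<parallel>V f\<parallel> \<le> \<surd>C \<cdot> \<parallel>f\<parallel>\<^sup>2 \<le> \<surd>C \<cdot> \<parallel>f\<parallel>\<close> on the unit ball. Norms therefore decay
  geometrically along orbits, which also rules out nonzero fixed points.\<close>

lemma norm_diag_quadratic_op_le:
  fixes b :: "real^3^3"
  shows "norm (diag_quadratic_op b f) \<le> sqrt (\<Sum>k\<in>UNIV. MAX i. \<bar>b $ i $ k\<bar>\<^sup>2) * (norm f)\<^sup>2"
proof -
  have norm_sq: "(\<Sum>i\<in>UNIV. (f $ i)\<^sup>2) = (norm f)\<^sup>2"
    by (simp add: norm_vec_def L2_set_def sum_nonneg)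
  have coord: "(diag_quadratic_op b f $ k)\<^sup>2 \<le> (MAX i. \<bar>b $ i $ k\<bar>\<^sup>2) * ((norm f)\<^sup>2)\<^sup>2" for k
  proof -
    define M where "M = (MAX i. \<bar>b $ i $ k\<bar>\<^sup>2)"
    have M: "\<bar>b $ i $ k\<bar>\<^sup>2 \<le> M" for i
      unfolding M_def by (rule Max_ge) auto
    have M0: "0 \<le> M"
      using M[of 1] zero_le_power2 order_trans by blast
    \<comment> \<open>\<open>sqrt M\<close> is the largest absolute value in column
      \<open>k\<close>; being independent of \<open>i\<close>, it factors out of the sum and leaves
      the squared norm of \<open>f\<close>.\<close>
    have c: "\<bar>b $ i $ k\<bar> \<le> sqrt M" for i
      using M[of i] real_le_rsqrt by blast
    have "\<bar>diag_quadratic_op b f $ k\<bar> \<le> (\<Sum>i\<in>UNIV. \<bar>b $ i $ k * (f $ i)\<^sup>2\<bar>)"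
      unfolding diag_quadratic_op_def by simp
    also have "\<dots> \<le> (\<Sum>i\<in>UNIV. sqrt M * (f $ i)\<^sup>2)"
      by (rule sum_mono) (simp add: abs_mult c mult_right_mono)
    also have "\<dots> = sqrt M * (norm f)\<^sup>2"
      by (simp add: norm_sq flip: sum_distrib_left)
    finally have "\<bar>diag_quadratic_op b f $ k\<bar>\<^sup>2 \<le> (sqrt M * (norm f)\<^sup>2)\<^sup>2"
      by (rule power_mono) simp
    then show ?thesis
      using M0 by (simp add: M_def power_mult_distrib)
  qed
  have "norm (diag_quadratic_op b f) = sqrt (\<Sum>k\<in>UNIV. (diag_quadratic_op b f $ k)\<^sup>2)"
    by (simp add: norm_vec_def L2_set_def)
  also have "\<dots> \<le> sqrt (\<Sum>k\<in>UNIV. (MAX i. \<bar>b $ i $ k\<bar>\<^sup>2) * ((norm f)\<^sup>2)\<^sup>2)"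
    by (intro real_sqrt_le_mono sum_mono coord)
  also have "\<dots> = sqrt (\<Sum>k\<in>UNIV. MAX i. \<bar>b $ i $ k\<bar>\<^sup>2) * (norm f)\<^sup>2"
    by (simp only: sum_distrib_right[symmetric] real_sqrt_mult real_sqrt_abs abs_power2)
  finally show ?thesis .
qed

text \<open>Iterating \<open>bound\<close> squeezes every orbit to 0. It compares \<open>V f\<close>
  with the origin only, not the images of two points, so this is not Banach's contraction principle,
  and \<open>S\<close> need not be complete.\<close>

lemma unique_stable_fixed_point_zeroI:
  fixes V :: "'a::real_normed_vector \<Rightarrow> 'a"
  assumes c: "0 \<le> c" "c < 1"
    and zero: "0 \<in> S"
    and self: "V ` S \<subseteq> S"
    and bound: "\<And>f. f \<in> S \<Longrightarrow> norm (V f) \<le> c * norm f"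
  shows "unique_stable_fixed_point S V 0"
proof -
  have "q = 0" if "q \<in> S" "V q = q" for q
  proof (rule ccontr)
    assume "q \<noteq> 0"
    then have "c * norm q < norm q"
      using c by simp
    with bound[OF \<open>q \<in> S\<close>] \<open>V q = q\<close> show False
      by simp
  qed
  moreover have "V 0 = 0"
    using bound[OF zero] by simp
  moreover have "(\<lambda>n. (V ^^ n) f) \<longlonglongrightarrow> 0" if f: "f \<in> S" for f
  proof -
    \<comment> \<open>Membership in \<open>S\<close> is carried through the induction because
      \<open>bound\<close> is available only on \<open>S\<close>.\<close>
    have orbit: "(V ^^ n) f \<in> S \<and> norm ((V ^^ n) f) \<le> c ^ n * norm f" for n
    proof (induction n)
      case 0
      then show ?case using f by simp
    next
      case (Suc n)
      then have "norm ((V ^^ Suc n) f) \<le> c * norm ((V ^^ n) f)"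
        using bound by simp
      also have "\<dots> \<le> c * (c ^ n * norm f)"
        using Suc c by (simp add: mult_left_mono)
      finally show ?case
        using Suc self by (auto simp: mult.assoc)
    qed
    have "(\<lambda>n. c ^ n * norm f) \<longlonglongrightarrow> 0"
      using c by (intro tendsto_mult_left_zero LIMSEQ_power_zero) simp
    then show ?thesis
      by (rule Lim_null_comparison[rotated]) (simp add: orbit)
  qed
  ultimately show ?thesis
    unfolding unique_stable_fixed_point_def using zero by blast
qed

theorem theorem4p11:
  fixes b :: "real^3^3"
  assumes "(\<Sum>k\<in>UNIV. MAX i. \<bar>b $ i $ k\<bar>\<^sup>2) < 1"
  shows "unique_stable_fixed_point (cball 0 1) (diag_quadratic_op b) 0"
proof (rule unique_stable_fixed_point_zeroI)
  let ?C = "\<Sum>k\<in>UNIV. MAX i. \<bar>b $ i $ k\<bar>\<^sup>2"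
  \<comment> \<open>A maximum is nonnegative as soon as one entry is, and here all entries are
    squares.\<close>
  have "0 \<le> (MAX i. \<bar>b $ i $ k\<bar>\<^sup>2)" for k
    by (auto simp: Max_ge_iff)
  then show C: "0 \<le> sqrt ?C"
    by (simp add: sum_nonneg)
  show "sqrt ?C < 1"
    using assms by simp
  show "diag_quadratic_op b ` cball 0 1 \<subseteq> cball 0 1"
    by (rule diag_quadratic_op_maps_ball[OF assms])
  show "norm (diag_quadratic_op b f) \<le> sqrt ?C * norm f" if "f \<in> cball 0 1" for f
  proof -
    \<comment> \<open>Radius 1 turns the quadratic estimate into a linear one.\<close>
    have "(norm f)\<^sup>2 \<le> norm f"
      using that by (simp add: power2_eq_square mult_left_le)
    with C show ?thesis
      by (intro order_trans[OF norm_diag_quadratic_op_le] mult_left_mono)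
  qed
qed simp

end
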